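(* Let $n,p,s$ be positive integers. Then: (1) $\mathbb{R}^{n\times n\times s}$ is a vector space over $\mathbb{R}$ of dimension $sn^2$; (2) $(\mathbb{R}^{n\times n\times s},\star)$ is a monoid (a semigroup with identity); (3) with $\mathbb{R}_0^{n\times n\times s}:=\{A\in\mathbb{R}^{n\times n\times s}\mid A\text{ is invertible}\}$, $(\mathbb{R}_0^{n\times n\times s},\star)$ is a group; (4) $(\mathbb{R}^{n\times n\times s},+,\star)$ is a ring with identity, and also an algebra (over $\mathbb{R}$); (5) for the ring $R:=(\mathbb{R}^{n\times n\times s},+,\star)$ and the abelian group $M:=(\mathbb{R}^{n\times p\times s},+)$, with the t-product $\star:R\times M\to M$ as the action of $R$ on $M$, $(R,M,\star)$ is a module.
   Context: A cubic matrix $A=(a_{i,j,k})\in\mathbb{R}^{m\times n\times s}$ has frontal slices $A^{(k)}=(a_{i,j,k})_{i,j}\in\mathbb{R}^{m\times n}$, $k\in[1,s]$, and is identified with the $sm\times n$ block-column matrix with blocks $A^{(1)},\dots,A^{(s)}$. Addition and scalar multiplication are entrywise. The block circulant matrix is $$\mathrm{bcirc}(A)=\begin{bmatrix} A^{(1)} & A^{(s)} & A^{(s-1)} & \cdots & A^{(2)} \\ A^{(2)} & A^{(1)} & A^{(s)} & \cdots & A^{(3)} \\ \vdots & & & \ddots & \vdots \\ A^{(s)} & A^{(s-1)} & A^{(s-2)} & \cdots & A^{(1)} \end{bmatrix}\in\mathbb{R}^{sm\times sn}.$$ For $A\in\mathbb{R}^{m\times n\times s}$, $B\in\mathbb{R}^{n\times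 p\times s}$ the t-product is $A\star B:=\mathrm{bcirc}(A)\,B\in\mathbb{R}^{m\times p\times s}$. The identity of $\mathbb{R}^{n\times n\times s}$ is the cubic matrix $I_n^s$ with first frontal slice $I_n$ and all other frontal slices $0$. $A\in\mathbb{R}^{n\times n\times s}$ is invertible if there is $B\in\mathbb{R}^{n\times n\times s}$ with $A\star B=B\star A=I_n^s$. Module means: $r\star(a+b)=r\star a+r\star b$, $(r_1+r_2)\star a=r_1\star a+r_2\star a$, $r_1\star(r_2\star a)=(r_1\star r_2)\star a$ for $r,r_1,r_2\in R$, $a,b\in M$. *)

theory Defs
  imports "Jordan_Normal_Form.Matrix" "Jordan_Normal_Form.VS_Connect"
begin

text \<open>
  An \<open>m \<times> n \<times> s\<close> cubic matrix is a real function on the index box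
  \<open>{0..<m} \<times> {0..<n} \<times> {0..<s}\<close>, made extensional so that equality of cubic matrices is
  equality of entries. All indices are 0-based, so the \<open>k\<close>-th frontal slice of the usual
  1-based notation is \<open>frontal m n A (k - 1)\<close>.
\<close>

type_synonym cubic = "nat \<times> nat \<times> nat \<Rightarrow> real"

definition cubic_box :: "nat \<Rightarrow> nat \<Rightarrow> nat \<Rightarrow> (nat \<times> nat \<times> nat) set" where
  "cubic_box m n s = {..<m} \<times> {..<n} \<times> {..<s}"

definition cubic :: "nat \<Rightarrow> nat \<Rightarrow> nat \<Rightarrow> cubic set" where
  "cubic m n s = cubic_box m n s \<rightarrow>\<^sub>E UNIV"

definition frontal :: "nat \<Rightarrow> nat \<Rightarrow> cubic \<Rightarrow> nat \<Rightarrow> real mat" where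
  "frontal m n A k = mat m n (\<lambda>(i, j). A (i, j, k))"

text \<open>
  The identification of cubic matrices with \<open>sm \<times> n\<close> block columns: \<open>block_col\<close> stacks the
  frontal slices, and \<open>of_block_col\<close> is the inverse map.
\<close>

definition block_col :: "nat \<Rightarrow> nat \<Rightarrow> nat \<Rightarrow> cubic \<Rightarrow> real mat" where
  "block_col m n s A =
     mat (s * m) n (\<lambda>(I, j). frontal m n A (I div m) $$ (I mod m, j))"

definition of_block_col :: "nat \<Rightarrow> nat \<Rightarrow> nat \<Rightarrow> real mat \<Rightarrow> cubic" where
  "of_block_col m n s X = (\<lambda>(i, j, k) \<in> cubic_box m n s. X $$ (k * m + i, j))"

text \<open>
  The block in (0-based) block row \<open>K\<close> and block column \<open>L\<close> of the block circulant matrix is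
  the frontal slice with index \<open>K - L\<close> modulo \<open>s\<close>; adding \<open>s\<close> avoids truncated subtraction.
\<close>

definition bcirc :: "nat \<Rightarrow> nat \<Rightarrow> nat \<Rightarrow> cubic \<Rightarrow> real mat" where
  "bcirc m n s A =
     mat (s * m) (s * n)
       (\<lambda>(I, J). frontal m n A ((I div m + s - J div n) mod s) $$ (I mod m, J mod n))"

definition tprod :: "nat \<Rightarrow> nat \<Rightarrow> nat \<Rightarrow> nat \<Rightarrow> cubic \<Rightarrow> cubic \<Rightarrow> cubic" where
  "tprod m n p s A B = of_block_col m p s (bcirc m n s A * block_col n p s B)"

definition cubic_add :: "nat \<Rightarrow> nat \<Rightarrow> nat \<Rightarrow> cubic \<Rightarrow> cubic \<Rightarrow> cubic" where
  "cubic_add m n s A B = (\<lambda>x \<in> cubic_box m n s. A x + B x)"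

definition cubic_smult :: "nat \<Rightarrow> nat \<Rightarrow> nat \<Rightarrow> real \<Rightarrow> cubic \<Rightarrow> cubic" where
  "cubic_smult m n s c A = (\<lambda>x \<in> cubic_box m n s. c * A x)"

definition cubic_zero :: "nat \<Rightarrow> nat \<Rightarrow> nat \<Rightarrow> cubic" where
  "cubic_zero m n s = (\<lambda>x \<in> cubic_box m n s. 0)"

definition cubic_id :: "nat \<Rightarrow> nat \<Rightarrow> cubic" where
  "cubic_id n s = (\<lambda>(i, j, k) \<in> cubic_box n n s. if k = 0 \<and> i = j then 1 else 0)"

definition cubic_invertible :: "nat \<Rightarrow> nat \<Rightarrow> cubic \<Rightarrow> bool" where
  "cubic_invertible n s A \<longleftrightarrow> A \<in> cubic n n s \<and>
     (\<exists>B \<in> cubic n n s. tprod n n n s A B = cubic_id n s \<and> tprod n n n s B A = cubic_id n s)"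

text \<open>
  The library's module records carry multiplicative components that play no role in a vector
  space; they are left undefined here, as in \<^const>\<open>module_vec\<close>.
\<close>

definition cubic_space :: "nat \<Rightarrow> nat \<Rightarrow> nat \<Rightarrow> (real, cubic) module" where
  "cubic_space m n s = \<lparr>
     carrier = cubic m n s,
     mult = undefined,
     one = undefined,
     zero = cubic_zero m n s,
     add = cubic_add m n s,
     smult = cubic_smult m n s\<rparr>"

definition tprod_monoid :: "nat \<Rightarrow> nat \<Rightarrow> cubic monoid" where
  "tprod_monoid n s = \<lparr>carrier = cubic n n s, mult = tprod n n n s, one = cubic_id n s\<rparr>"

definition tprod_group :: "nat \<Rightarrow> nat \<Rightarrow> cubic monoid" where
  "tprod_group n s =
     \<lparr>carrier = {A. cubic_invertible n s A}, mult = tprod n n n s, one = cubic_id n s\<rparr>"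

definition tprod_ring :: "nat \<Rightarrow> nat \<Rightarrow> cubic ring" where
  "tprod_ring n s = \<lparr>
     carrier = cubic n n s,
     mult = tprod n n n s,
     one = cubic_id n s,
     zero = cubic_zero n n s,
     add = cubic_add n n s\<rparr>"

definition tprod_algebra :: "nat \<Rightarrow> nat \<Rightarrow> (real, cubic) module" where
  "tprod_algebra n s = \<lparr>
     carrier = cubic n n s,
     mult = tprod n n n s,
     one = cubic_id n s,
     zero = cubic_zero n n s,
     add = cubic_add n n s,
     smult = cubic_smult n n s\<rparr>"

text \<open>
  The locale \<^locale>\<open>algebra\<close> of HOL-Algebra requires a commutative product and
  \<^locale>\<open>module\<close> a commutative ring of scalars, so neither covers the t-product.
\<close>

locale assoc_algebra = vectorspace K A + ring A for K and A (structure) +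
  assumes smult_mult_left:
      "\<lbrakk>c \<in> carrier K; x \<in> carrier A; y \<in> carrier A\<rbrakk>
        \<Longrightarrow> (c \<odot> x) \<otimes> y = c \<odot> (x \<otimes> y)"
    and smult_mult_right:
      "\<lbrakk>c \<in> carrier K; x \<in> carrier A; y \<in> carrier A\<rbrakk>
        \<Longrightarrow> x \<otimes> (c \<odot> y) = c \<odot> (x \<otimes> y)"

text \<open>No unit law \<open>act \<one> a = a\<close> is demanded of a module.\<close>

locale left_module = R: ring R + M: abelian_group M
  for R :: "('r, 'c) ring_scheme" (structure)
    and M :: "('m, 'd) ring_scheme" (structure)
    and act :: "'r \<Rightarrow> 'm \<Rightarrow> 'm" +
  assumes act_closed:
      "\<lbrakk>r \<in> carrier R; a \<in> carrier M\<rbrakk> \<Longrightarrow> act r a \<in> carrier M"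
    and act_add_right:
      "\<lbrakk>r \<in> carrier R; a \<in> carrier M; b \<in> carrier M\<rbrakk>
        \<Longrightarrow> act r (a \<oplus>\<^bsub>M\<^esub> b) = act r a \<oplus>\<^bsub>M\<^esub> act r b"
    and act_add_left:
      "\<lbrakk>r1 \<in> carrier R; r2 \<in> carrier R; a \<in> carrier M\<rbrakk>
        \<Longrightarrow> act (r1 \<oplus>\<^bsub>R\<^esub> r2) a = act r1 a \<oplus>\<^bsub>M\<^esub> act r2 a"
    and act_assoc:
      "\<lbrakk>r1 \<in> carrier R; r2 \<in> carrier R; a \<in> carrier M\<rbrakk>
        \<Longrightarrow> act r1 (act r2 a) = act (r1 \<otimes>\<^bsub>R\<^esub> r2) a"

end

theory Submission
  imports Defs
begin

text \<open>
  In entries, the t-product is a matrix product in the first two indices combined with cyclic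
  convolution modulo \<open>s\<close> in the third. Associativity therefore reduces to that of cyclic
  convolution, where the inner sum is shifted cyclically; all other laws hold entrywise.
  The vector space has the indicator functions of the points of the index box as a basis.
\<close>

section \<open>Entries of cubic matrices\<close>

lemma cubic_eqI:
  assumes "A \<in> cubic m n s" and "B \<in> cubic m n s"
    and "\<And>i j k. \<lbrakk>i < m; j < n; k < s\<rbrakk> \<Longrightarrow> A (i, j, k) = B (i, j, k)"
  shows "A = B"
  using assms unfolding cubic_def cubic_box_def by (intro PiE_ext) auto

lemma tprod_closed: "tprod m n p s A B \<in> cubic m p s"
  by (auto simp: tprod_def of_block_col_def cubic_def)

lemma cubic_add_closed: "cubic_add m n s A B \<in> cubic m n s"
  by (auto simp: cubic_add_def cubic_def)

lemma cubic_smult_closed: "cubic_smult m n s c A \<in> cubic m n s"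
  by (auto simp: cubic_smult_def cubic_def)

lemma cubic_zero_closed: "cubic_zero m n s \<in> cubic m n s"
  by (auto simp: cubic_zero_def cubic_def)

lemma cubic_id_closed: "cubic_id n s \<in> cubic n n s"
  by (auto simp: cubic_id_def cubic_def)

lemmas cubic_closed =
  tprod_closed cubic_add_closed cubic_smult_closed cubic_zero_closed cubic_id_closed

lemma cubic_add_entry:
  "\<lbrakk>i < m; j < n; k < s\<rbrakk> \<Longrightarrow> cubic_add m n s A B (i, j, k) = A (i, j, k) + B (i, j, k)"
  by (simp add: cubic_add_def cubic_box_def)

lemma cubic_smult_entry:
  "\<lbrakk>i < m; j < n; k < s\<rbrakk> \<Longrightarrow> cubic_smult m n s c A (i, j, k) = c * A (i, j, k)"
  by (simp add: cubic_smult_def cubic_box_def)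

lemma cubic_zero_entry:
  "\<lbrakk>i < m; j < n; k < s\<rbrakk> \<Longrightarrow> cubic_zero m n s (i, j, k) = 0"
  by (simp add: cubic_zero_def cubic_box_def)

lemma cubic_id_entry:
  "\<lbrakk>i < n; j < n; k < s\<rbrakk> \<Longrightarrow> cubic_id n s (i, j, k) = (if k = 0 \<and> i = j then 1 else 0)"
  by (simp add: cubic_id_def cubic_box_def)

lemma block_index_less:
  fixes i k m s :: nat
  assumes "i < m" and "k < s"
  shows "k * m + i < s * m"
proof -
  have "k * m + i < Suc k * m" using assms(1) by simp
  also have "\<dots> \<le> s * m" using assms(2) by (intro mult_le_mono1) simp
  finally show ?thesis .
qed

text \<open>Division with remainder by \<open>n\<close> is a bijection from
  \<open>{..<s * n}\<close> onto the pairs (block, position in the block), with inverse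
  \<open>(l, q)\<close> to \<open>l * n + q\<close>.\<close>

lemma sum_div_mod:
  fixes f :: "nat \<Rightarrow> nat \<Rightarrow> 'a::comm_monoid_add"
  shows "(\<Sum>J<s * n. f (J div n) (J mod n)) = (\<Sum>l<s. \<Sum>q<n. f l q)"
proof -
  have "(\<Sum>J<s * n. f (J div n) (J mod n)) = (\<Sum>(l, q)\<in>{..<s} \<times> {..<n}. f l q)"
  proof (rule sum.reindex_bij_witness[where i = "\<lambda>(l, q). l * n + q" and j = "\<lambda>J. (J div n, J mod n)"])
    fix J assume "J \<in> {..<s * n}"
    then have "J < s * n" and "n > 0" by (auto intro: gr0I)
    then show "(J div n, J mod n) \<in> {..<s} \<times> {..<n}"
      by (simp add: less_mult_imp_div_less)
  qed (auto simp: block_index_less)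
  then show ?thesis by (simp add: sum.cartesian_product)
qed

text \<open>The working formula for the t-product: every law below is derived from it, and block
  matrices do not appear again.\<close>

lemma tprod_entry:
  assumes "i < m" and "j < p" and "k < s"
  shows "tprod m n p s A B (i, j, k) =
    (\<Sum>l<s. \<Sum>q<n. A (i, q, (k + s - l) mod s) * B (q, j, l))"
proof -
  have "tprod m n p s A B (i, j, k) = (\<Sum>J<s * n.
      A (i, J mod n, (k + s - J div n) mod s) * B (J mod n, j, J div n))"
    using assms block_index_less[OF assms(1,3)]
    \<comment> \<open>For \<open>n = 0\<close> both sums vanish; otherwise
      \<open>J mod n < n\<close>, so the entries of the slices can be read off.\<close>
    by (cases "n = 0")
      (auto simp: tprod_def of_block_col_def cubic_box_def bcirc_def block_col_def frontal_def
        scalar_prod_def lessThan_atLeast0 less_mult_imp_div_less intro!: sum.cong)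
  then show ?thesis
    using sum_div_mod[of "\<lambda>l q. A (i, q, (k + s - l) mod s) * B (q, j, l)"] by simp
qed

lemmas cubic_entry =
  cubic_add_entry cubic_smult_entry cubic_zero_entry cubic_id_entry tprod_entry

section \<open>Laws of the t-product\<close>

text \<open>Since \<open>a + s - b\<close> lies strictly between 0 and \<open>2 * s\<close>, at most
  one \<open>s\<close> has to be removed. This trades \<open>mod\<close> for a case distinction that
  linear arithmetic can handle.\<close>

lemma cyclic_diff:
  fixes a b s :: nat
  assumes "a < s" and "b < s"
  shows "(a + s - b) mod s = (if b \<le> a then a - b else a + s - b)"
proof (cases "b \<le> a")
  case True
  then have "a + s - b = (a - b) + s" by simp
  then show ?thesis using assms True by (simp only: mod_add_self2) simp
qed (use assms in simp)

text \<open>Subtracting \<open>l\<close> permutes the residues modulo \<open>s\<close>; adding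
  \<open>l\<close> is the inverse.\<close>

lemma sum_cyclic_shift:
  fixes f :: "nat \<Rightarrow> 'a::comm_monoid_add"
  assumes "l < s"
  shows "(\<Sum>r<s. f ((r + s - l) mod s)) = (\<Sum>r<s. f r)"
proof (rule sum.reindex_bij_witness[where i = "\<lambda>r. (r + l) mod s" and j = "\<lambda>r. (r + s - l) mod s"])
  fix r assume "r \<in> {..<s}"
  then have r: "r < s" by simp
  show "((r + s - l) mod s + l) mod s = r"
    using assms r by (simp add: cyclic_diff)
  show "((r + l) mod s + s - l) mod s = r"
    using assms r by (cases "r + l < s") (simp_all add: cyclic_diff mod_if[of "r + l"])
qed (use assms in auto)

text \<open>This is (k - l) - (r - l) = k - r in the integers modulo \<open>s\<close>.\<close>

lemma cyclic_diff_diff: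
  fixes k l r s :: nat
  assumes "k < s" and "l < s" and "r < s"
  shows "((k + s - l) mod s + s - (r + s - l) mod s) mod s = (k + s - r) mod s"
proof -
  \<comment> \<open>If k < l \<le> r, the argument on the left is k + 2s - r, one period above the
    one on the right.\<close>
  have "(k + s + s - r) mod s = (k + s - r) mod s"
    using mod_add_self2[of "k + s - r" s] assms by simp
  then show ?thesis
    using assms by (cases "l \<le> k"; cases "l \<le> r"; cases "r \<le> k") (simp_all add: cyclic_diff)
qed

text \<open>For each \<open>l\<close> the inner index \<open>r\<close> is replaced by r - l modulo
  \<open>s\<close>, which frees the argument of \<open>f\<close> from \<open>l\<close>; then the two
  sums are exchanged.\<close>

lemma cyclic_convolution_assoc:
  fixes f g h :: "nat \<Rightarrow> 'a::comm_semiring_0"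
  assumes "k < s"
  shows "(\<Sum>l<s. (\<Sum>r<s. f (((k + s - l) mod s + s - r) mod s) * g r) * h l) =
    (\<Sum>r<s. f ((k + s - r) mod s) * (\<Sum>l<s. g ((r + s - l) mod s) * h l))"
proof -
  have "(\<Sum>l<s. (\<Sum>r<s. f (((k + s - l) mod s + s - r) mod s) * g r) * h l) =
      (\<Sum>l<s. (\<Sum>r<s. f ((k + s - r) mod s) * g ((r + s - l) mod s)) * h l)"
  proof (rule sum.cong[OF refl])
    fix l assume "l \<in> {..<s}"
    then have l: "l < s" by simp
    have "(\<Sum>r<s. f (((k + s - l) mod s + s - r) mod s) * g r) =
        (\<Sum>r<s. f (((k + s - l) mod s + s - (r + s - l) mod s) mod s) * g ((r + s - l) mod s))"
      by (rule sum_cyclic_shift[OF l, symmetric])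
    also have "\<dots> = (\<Sum>r<s. f ((k + s - r) mod s) * g ((r + s - l) mod s))"
      using assms l by (intro sum.cong) (auto simp: cyclic_diff_diff)
    finally show "(\<Sum>r<s. f (((k + s - l) mod s + s - r) mod s) * g r) * h l =
        (\<Sum>r<s. f ((k + s - r) mod s) * g ((r + s - l) mod s)) * h l" by simp
  qed
  also have "\<dots> = (\<Sum>r<s. f ((k + s - r) mod s) * (\<Sum>l<s. g ((r + s - l) mod s) * h l))"
    unfolding sum_distrib_left sum_distrib_right
    by (subst sum.swap) (simp add: mult.assoc)
  finally show ?thesis .
qed

text \<open>For fixed matrix indices \<open>t\<close> and \<open>q\<close> the claim is
  associativity of cyclic convolution in the slice index; the rest is reordering of finite
  sums.\<close>

lemma tprod_assoc:
  "tprod m p u s (tprod m n p s A B) C = tprod m n u s A (tprod n p u s B C)"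
proof (rule cubic_eqI[OF tprod_closed tprod_closed])
  fix i j k assume ijk: "i < m" "j < u" "k < s"
  have "tprod m p u s (tprod m n p s A B) C (i, j, k) =
      (\<Sum>l<s. \<Sum>q<p. (\<Sum>r<s. \<Sum>t<n.
        A (i, t, ((k + s - l) mod s + s - r) mod s) * B (t, q, r)) * C (q, j, l))"
    using ijk by (simp add: tprod_entry)
  also have "\<dots> = (\<Sum>q<p. \<Sum>t<n. \<Sum>l<s. (\<Sum>r<s.
        A (i, t, ((k + s - l) mod s + s - r) mod s) * B (t, q, r)) * C (q, j, l))"
    \<comment> \<open>The matrix indices move outside, leaving a double cyclic convolution
      inside.\<close>
    by (subst sum.swap, rule sum.cong[OF refl], subst (2) sum.swap, subst sum.swap)
      (simp add: sum_distrib_right)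
  also have "\<dots> = (\<Sum>q<p. \<Sum>t<n. \<Sum>r<s. A (i, t, (k + s - r) mod s) *
        (\<Sum>l<s. B (t, q, (r + s - l) mod s) * C (q, j, l)))"
    using ijk(3) by (subst cyclic_convolution_assoc) auto
  also have "\<dots> = (\<Sum>r<s. \<Sum>t<n. A (i, t, (k + s - r) mod s) *
        (\<Sum>l<s. \<Sum>q<p. B (t, q, (r + s - l) mod s) * C (q, j, l)))"
  \<comment> \<open>The sums return to the order of the entry formula, slice index before matrix
    index.\<close>
  proof -
    have "(\<Sum>l<s. \<Sum>q<p. B (t, q, (r + s - l) mod s) * C (q, j, l)) =
        (\<Sum>q<p. \<Sum>l<s. B (t, q, (r + s - l) mod s) * C (q, j, l))" for t r
      by (rule sum.swap)
    then show ?thesis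
      by (subst sum.swap, subst (2) sum.swap, subst sum.swap) (simp add: sum_distrib_left)
  qed
  also have "\<dots> = tprod m n u s A (tprod n p u s B C) (i, j, k)"
    using ijk by (simp add: tprod_entry)
  finally show "tprod m p u s (tprod m n p s A B) C (i, j, k) =
      tprod m n u s A (tprod n p u s B C) (i, j, k)" .
qed

lemma tprod_id_left:
  assumes "A \<in> cubic n p s"
  shows "tprod n n p s (cubic_id n s) A = A"
proof (rule cubic_eqI[OF tprod_closed assms])
  fix i j k assume ijk: "i < n" "j < p" "k < s"
  \<comment> \<open>The identity has only slice 0 nonzero, so only \<open>l = k\<close>
    contributes.\<close>
  have *: "(k + s - l) mod s = 0 \<longleftrightarrow> l = k" if "l < s" for l
    using that ijk(3) by (auto simp: cyclic_diff)
  have "tprod n n p s (cubic_id n s) A (i, j, k) =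
      (\<Sum>l<s. \<Sum>q<n. (if l = k \<and> i = q then 1 else 0) * A (q, j, l))"
    using ijk by (auto simp: tprod_entry cubic_id_entry * intro!: sum.cong)
  \<comment> \<open>Nested conditionals let the two sums collapse one after the other.\<close>
  also have "\<dots> = (\<Sum>l<s. \<Sum>q<n. if i = q then if l = k then A (q, j, l) else 0 else 0)"
    by (intro sum.cong) auto
  also have "\<dots> = A (i, j, k)"
    using ijk by simp
  finally show "tprod n n p s (cubic_id n s) A (i, j, k) = A (i, j, k)" .
qed

lemma tprod_id_right:
  assumes "A \<in> cubic m n s"
  shows "tprod m n n s A (cubic_id n s) = A"
proof (rule cubic_eqI[OF tprod_closed assms])
  fix i j k assume ijk: "i < m" "j < n" "k < s"
  have "tprod m n n s A (cubic_id n s) (i, j, k) = (\<Sum>l<s. \<Sum>q<n.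
      A (i, q, (k + s - l) mod s) * (if l = 0 \<and> q = j then 1 else 0))"
    using ijk by (simp add: tprod_entry cubic_id_entry)
  also have "\<dots> = (\<Sum>l<s. \<Sum>q<n.
      if q = j then if l = 0 then A (i, q, (k + s - l) mod s) else 0 else 0)"
    by (intro sum.cong) auto
  \<comment> \<open>At \<open>l = 0\<close> the slice index is
    \<open>(k + s) mod s = k\<close>.\<close>
  also have "\<dots> = A (i, j, k)"
    using ijk by simp
  finally show "tprod m n n s A (cubic_id n s) (i, j, k) = A (i, j, k)" .
qed

section \<open>Bilinearity\<close>

lemma tprod_add_left:
  "tprod m n p s (cubic_add m n s A B) C = cubic_add m p s (tprod m n p s A C) (tprod m n p s B C)"
  by (rule cubic_eqI[where m = m and n = p and s = s])
    (simp_all add: cubic_closed cubic_entry distrib_right sum.distrib)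

lemma tprod_add_right:
  "tprod m n p s A (cubic_add n p s B C) = cubic_add m p s (tprod m n p s A B) (tprod m n p s A C)"
  by (rule cubic_eqI[where m = m and n = p and s = s])
    (simp_all add: cubic_closed cubic_entry distrib_left sum.distrib)

lemma tprod_smult_left:
  "tprod m n p s (cubic_smult m n s c A) B = cubic_smult m p s c (tprod m n p s A B)"
  by (rule cubic_eqI[where m = m and n = p and s = s])
    (simp_all add: cubic_closed cubic_entry sum_distrib_left mult.assoc)

lemma tprod_smult_right:
  "tprod m n p s A (cubic_smult n p s c B) = cubic_smult m p s c (tprod m n p s A B)"
  by (rule cubic_eqI[where m = m and n = p and s = s])
    (simp_all add: cubic_closed cubic_entry sum_distrib_left mult.left_commute)

section \<open>Algebraic structures\<close>

text \<open>Only the additive fields of \<open>G\<close> are prescribed, so that the lemma serves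
  the vector space, the ring and the algebra alike.\<close>

lemma abelian_group_cubic:
  fixes G (structure)
  assumes G: "carrier G = cubic m n s" "add G = cubic_add m n s" "zero G = cubic_zero m n s"
  shows "abelian_group G"
proof (rule abelian_groupI)
  fix A assume A: "A \<in> carrier G"
  \<comment> \<open>The additive inverse is the scalar multiple by -1.\<close>
  have "cubic_add m n s (cubic_smult m n s (- 1) A) A = cubic_zero m n s"
    by (rule cubic_eqI[where m = m and n = n and s = s]) (simp_all add: cubic_closed cubic_entry)
  then show "\<exists>B\<in>carrier G. B \<oplus> A = \<zero>"
    using G cubic_smult_closed by metis
  show "\<zero> \<oplus> A = A"
    using A by (intro cubic_eqI[where m = m and n = n and s = s])
      (simp_all add: G cubic_closed cubic_entry)
qed (auto simp: G cubic_closed cubic_entry algebra_simps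
    intro!: cubic_eqI[where m = m and n = n and s = s])

lemma vectorspace_cubic:
  assumes G: "carrier G = cubic m n s" "add G = cubic_add m n s" "zero G = cubic_zero m n s"
    "module.smult G = cubic_smult m n s"
  shows "vectorspace (class_ring :: real ring) G"
proof -
  interpret abelian_group G
    by (rule abelian_group_cubic[OF G(1-3)])
  show ?thesis
    by unfold_locales (auto simp: G cubic_closed cubic_entry algebra_simps
        intro!: cubic_eqI[where m = m and n = n and s = s])
qed

section \<open>Standard basis and dimension\<close>

definition cubic_unit :: "nat \<Rightarrow> nat \<Rightarrow> nat \<Rightarrow> nat \<times> nat \<times> nat \<Rightarrow> cubic" where
  "cubic_unit m n s b = (\<lambda>x \<in> cubic_box m n s. if x = b then 1 else 0)"

lemma cubic_unit_closed: "cubic_unit m n s b \<in> cubic m n s"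
  by (auto simp: cubic_unit_def cubic_def)

text \<open>Evaluation at \<open>b\<close> separates the units. Injectivity turns sums over the
  basis into sums over the box and gives the size of the basis.\<close>

lemma inj_on_cubic_unit: "inj_on (cubic_unit m n s) (cubic_box m n s)"
proof (rule inj_onI)
  fix b c assume "b \<in> cubic_box m n s" and "cubic_unit m n s b = cubic_unit m n s c"
  then have "cubic_unit m n s b b = cubic_unit m n s c b" and "b \<in> cubic_box m n s" by simp_all
  then show "b = c" by (simp add: cubic_unit_def split: if_splits)
qed

lemma finite_cubic_box: "finite (cubic_box m n s)"
  by (simp add: cubic_box_def)

text \<open>Evaluation at a point of the box is additive. For infinite \<open>X\<close> both sums
  are 0 by convention.\<close>

lemma finsum_cubic_space:
  assumes "f \<in> X \<rightarrow> cubic m n s" and "x \<in> cubic_box m n s"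
  shows "finsum (cubic_space m n s) f X x = (\<Sum>v\<in>X. f v x)"
proof -
  interpret abelian_group "cubic_space m n s"
    by (rule abelian_group_cubic) (simp_all add: cubic_space_def)
  have zero: "zero (cubic_space m n s) x = 0" if "x \<in> cubic_box m n s" for x
    using that by (simp add: cubic_space_def cubic_zero_def)
  show ?thesis
    using assms(1)
  proof (induction X rule: infinite_finite_induct)
    case (insert v X)
    then show ?case
      using assms(2) by (subst finsum_insert) (auto simp: cubic_space_def cubic_add_def)
  qed (use assms(2) in \<open>simp_all add: zero\<close>)
qed

lemma cubic_space_dim:
  "vectorspace.fin_dim (class_ring :: real ring) (cubic_space m n s)"
  "vectorspace.dim (class_ring :: real ring) (cubic_space m n s) = m * n * s"
proof -
  let ?V = "cubic_space m n s" and ?U = "cubic_unit m n s" and ?X = "cubic_box m n s"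
  have V: "carrier ?V = cubic m n s" "zero ?V = cubic_zero m n s"
    "module.smult ?V = cubic_smult m n s"
    by (simp_all add: cubic_space_def)
  interpret vectorspace "class_ring :: real ring" ?V
    by (rule vectorspace_cubic) (simp_all add: cubic_space_def)
  have fin: "finite (?U ` ?X)"
    by (simp add: finite_cubic_box)
  have sub: "?U ` ?X \<subseteq> carrier ?V"
    by (auto simp: V cubic_unit_closed)
  \<comment> \<open>The entry at \<open>x\<close> is the coefficient of the unit at
    \<open>x\<close>; independence and spanning both follow from this.\<close>
  have coeff: "lincomb a (?U ` ?X) x = a (?U x)" if x: "x \<in> ?X" for a x
  proof -
    have "lincomb a (?U ` ?X) x = (\<Sum>v\<in>?U ` ?X. cubic_smult m n s (a v) v x)"
      unfolding lincomb_def V by (rule finsum_cubic_space) (use x in \<open>auto simp: cubic_smult_closed\<close>)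
    also have "\<dots> = (\<Sum>b\<in>?X. if x = b then a (?U b) else 0)"
      using x by (subst sum.reindex[OF inj_on_cubic_unit])
        (auto simp: cubic_smult_def cubic_unit_def intro!: sum.cong)
    also have "\<dots> = a (?U x)"
      using x by (simp add: finite_cubic_box)
    finally show ?thesis .
  qed
  have indpt: "lin_indpt (?U ` ?X)"
  proof (rule finite_lin_indpt2[OF fin sub])
    fix a assume "lincomb a (?U ` ?X) = \<zero>\<^bsub>?V\<^esub>"
    then show "\<forall>v\<in>?U ` ?X. a v = \<zero>\<^bsub>class_ring\<^esub>"
      using coeff[of _ a] by (auto simp: V cubic_zero_def)
  qed
  have span: "span (?U ` ?X) = carrier ?V"
  proof (rule equalityI)
    show "span (?U ` ?X) \<subseteq> carrier ?V"
      using sub by (rule span_is_subset2)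
    show "carrier ?V \<subseteq> span (?U ` ?X)"
    proof
      fix A assume A: "A \<in> carrier ?V"
      \<comment> \<open>The coefficient of a unit is the entry of \<open>A\<close> at the point to
        which the unit belongs.\<close>
      define a where "a v = A (the_inv_into ?X ?U v)" for v
      have "lincomb a (?U ` ?X) \<in> carrier ?V"
        using sub by (intro lincomb_closed) simp_all
      then have "A = lincomb a (?U ` ?X)"
        using A unfolding V cubic_def
        by (rule_tac PiE_ext) (auto simp: coeff a_def the_inv_into_f_f[OF inj_on_cubic_unit])
      then show "A \<in> span (?U ` ?X)"
        using fin by (auto simp: finite_span[OF fin sub])
    qed
  qed
  show "fin_dim"
    unfolding fin_dim_def using fin sub span by blast
  have "dim = card (?U ` ?X)"
    using indpt span sub by (intro dim_basis[OF fin]) (simp add: basis_def)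
  then show "dim = m * n * s"
    by (simp add: card_image[OF inj_on_cubic_unit])
      (simp add: cubic_box_def card_cartesian_product)
qed

section \<open>Monoid, group, ring, algebra and module\<close>

lemma monoid_tprod: "monoid (tprod_monoid n s)"
  by unfold_locales
    (simp_all add: tprod_monoid_def cubic_closed tprod_assoc tprod_id_left tprod_id_right)

text \<open>The invertible cubic matrices are exactly the units of the monoid, and the units of any
  monoid form a group.\<close>

lemma group_tprod: "group (tprod_group n s)"
proof -
  interpret monoid "tprod_monoid n s" by (rule monoid_tprod)
  have "tprod_group n s = units_of (tprod_monoid n s)"
    by (auto simp: tprod_group_def tprod_monoid_def units_of_def Units_def cubic_invertible_def)
  then show ?thesis by (simp add: units_group)
qed

lemma ring_tprod:
  fixes G (structure)
  assumes G: "carrier G = cubic n n s" "add G = cubic_add n n s" "zero G = cubic_zero n n s"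
    "mult G = tprod n n n s" "one G = cubic_id n s"
  shows "ring G"
proof (rule ringI)
  show "abelian_group G"
    using G(1-3) by (rule abelian_group_cubic)
  show "monoid G"
    by unfold_locales (simp_all add: G cubic_closed tprod_assoc tprod_id_left tprod_id_right)
qed (simp_all add: G tprod_add_left tprod_add_right)

lemma assoc_algebra_tprod: "assoc_algebra (class_ring :: real ring) (tprod_algebra n s)"
proof -
  interpret vectorspace "class_ring :: real ring" "tprod_algebra n s"
    by (rule vectorspace_cubic) (simp_all add: tprod_algebra_def)
  interpret A: ring "tprod_algebra n s"
    by (rule ring_tprod) (simp_all add: tprod_algebra_def)
  show ?thesis
    by unfold_locales (simp_all add: tprod_algebra_def tprod_smult_left tprod_smult_right)
qed

text \<open>The laws of the t-product were proved for rectangular formats, so the module axioms are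
  instances of them.\<close>

lemma left_module_tprod: "left_module (tprod_ring n s) (cubic_space n p s) (tprod n n p s)"
proof -
  interpret R: ring "tprod_ring n s"
    by (rule ring_tprod) (simp_all add: tprod_ring_def)
  interpret M: abelian_group "cubic_space n p s"
    by (rule abelian_group_cubic) (simp_all add: cubic_space_def)
  show ?thesis
    by unfold_locales (simp_all add: tprod_ring_def cubic_space_def cubic_closed
        tprod_add_left tprod_add_right tprod_assoc)
qed

theorem corollary1:
  fixes n p s :: nat
  assumes "n > 0" and "p > 0" and "s > 0"
  shows "(vectorspace (class_ring :: real ring) (cubic_space n n s) \<and>
          vectorspace.fin_dim (class_ring :: real ring) (cubic_space n n s) \<and>
          vectorspace.dim (class_ring :: real ring) (cubic_space n n s) = s * n ^ 2) \<and>
         monoid (tprod_monoid n s) \<and>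
         group (tprod_group n s) \<and>
         ring (tprod_ring n s) \<and>
         assoc_algebra (class_ring :: real ring) (tprod_algebra n s) \<and>
         left_module (tprod_ring n s) (cubic_space n p s) (tprod n n p s)"
proof (intro conjI)
  show "vectorspace (class_ring :: real ring) (cubic_space n n s)"
    by (rule vectorspace_cubic) (simp_all add: cubic_space_def)
  show "vectorspace.dim (class_ring :: real ring) (cubic_space n n s) = s * n ^ 2"
    by (simp add: cubic_space_dim power2_eq_square)
  show "ring (tprod_ring n s)"
    by (rule ring_tprod) (simp_all add: tprod_ring_def)
qed (rule cubic_space_dim monoid_tprod group_tprod assoc_algebra_tprod left_module_tprod)+

end
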